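(* There is no norm-perfect Eisenstein prime, i.e. no prime $\psi\in\mathbb{Z}[\omega]$ satisfies $N(\sigma(\psi))=3N(\psi)$.
   Context: $\omega=e^{2\pi i/3}$, $N(a+b\omega)=a^2-ab+b^2$. Positive primes: $\{a+b\omega: a>b\ge 0\}\cap\{\text{primes of }\mathbb{Z}[\omega]\}$; each prime has exactly one positive associate. For nonzero $\alpha=\varepsilon\prod\pi_j^{e_j}$ ($\varepsilon$ a unit, distinct positive primes $\pi_j$), $\sigma(\alpha)=\prod\frac{\pi_j^{e_j+1}-1}{\pi_j-1}$; in particular $\sigma(\psi)=\pi+1$ where $\pi$ is the positive associate of the prime $\psi$. *)

theory Defs
  imports Complex_Main "HOL-Computational_Algebra.Euclidean_Algorithm"
begin

section \<open>The ring of Eisenstein integers\<close>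

text \<open>\<open>Eis a b\<close> stands for \<open>a + b\<omega>\<close> with \<open>\<omega> = exp (2\<pi>\<i>/3)\<close>; lemmas \<open>inj_complex_of_eis\<close>, \<open>complex_of_eis_hom\<close>.\<close>

datatype eisenstein = Eis (rat_part: int) (om_part: int)

lemma eis_eq_iff: "x = y \<longleftrightarrow> rat_part x = rat_part y \<and> om_part x = om_part y"
  by (cases x; cases y) simp

definition eis_norm :: "eisenstein \<Rightarrow> int" where
  "eis_norm x = (rat_part x)\<^sup>2 - rat_part x * om_part x + (om_part x)\<^sup>2"

instantiation eisenstein :: comm_ring_1
begin

definition "0 = Eis 0 0"
definition "1 = Eis 1 0"
definition "x + y = Eis (rat_part x + rat_part y) (om_part x + om_part y)"
definition "- x = Eis (- rat_part x) (- om_part x)"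
definition "x - y = Eis (rat_part x - rat_part y) (om_part x - om_part y)"
definition "x * y = Eis
   (rat_part x * rat_part y - om_part x * om_part y)
   (rat_part x * om_part y + om_part x * rat_part y - om_part x * om_part y)"

lemmas eis_arith_defs = zero_eisenstein_def one_eisenstein_def plus_eisenstein_def
  uminus_eisenstein_def minus_eisenstein_def times_eisenstein_def

instance
  by standard (simp_all add: eis_arith_defs eis_eq_iff algebra_simps)

end

lemma eis_parts [simp]:
  "rat_part 0 = 0" "om_part 0 = 0" "rat_part 1 = 1" "om_part 1 = 0"
  "rat_part (x + y) = rat_part x + rat_part y" "om_part (x + y) = om_part x + om_part y"
  "rat_part (x - y) = rat_part x - rat_part y" "om_part (x - y) = om_part x - om_part y"
  "rat_part (- x) = - rat_part x" "om_part (- x) = - om_part x"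
  "rat_part (x * y) = rat_part x * rat_part y - om_part x * om_part y"
  "om_part (x * y) = rat_part x * om_part y + om_part x * rat_part y - om_part x * om_part y"
  by (simp_all add: eis_arith_defs)


subsection \<open>Embedding into the complex numbers\<close>

definition complex_of_eis :: "eisenstein \<Rightarrow> complex" where
  "complex_of_eis x = of_int (rat_part x) + of_int (om_part x) * cis (2 * pi / 3)"

lemma cis_two_pi_third: "cis (2 * pi / 3) = Complex (- 1 / 2) (sqrt 3 / 2)"
  by (simp add: complex_eq_iff cos_120 sin_120)

lemma complex_of_eis_eq:
  "complex_of_eis x = Complex (of_int (rat_part x) - of_int (om_part x) / 2) (of_int (om_part x) * sqrt 3 / 2)"
  by (simp add: complex_of_eis_def cis_two_pi_third complex_eq_iff)

lemma inj_complex_of_eis: "inj complex_of_eis"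
  by (rule injI) (auto simp: complex_of_eis_eq eis_eq_iff)

lemma complex_of_eis_hom:
  "complex_of_eis 1 = 1"
  "complex_of_eis (x + y) = complex_of_eis x + complex_of_eis y"
  "complex_of_eis (x * y) = complex_of_eis x * complex_of_eis y"
  by (simp_all add: complex_of_eis_eq complex_eq_iff field_simps)

lemma cmod_complex_of_eis: "(cmod (complex_of_eis x))\<^sup>2 = of_int (eis_norm x)"
  unfolding cmod_power2 by (simp add: complex_of_eis_eq eis_norm_def power2_eq_square field_simps)


subsection \<open>Euclidean structure\<close>

lemma eis_norm_mult: "eis_norm (x * y) = eis_norm x * eis_norm y"
  by (simp add: eis_norm_def power2_eq_square algebra_simps)

lemma four_eis_norm: "4 * eis_norm x = (2 * rat_part x - om_part x)\<^sup>2 + 3 * (om_part x)\<^sup>2"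
  by (simp add: eis_norm_def power2_eq_square algebra_simps)

lemma eis_norm_nonneg: "eis_norm x \<ge> 0"
proof -
  have "4 * eis_norm x \<ge> 0"
    unfolding four_eis_norm by simp
  then show ?thesis by simp
qed

lemma eis_norm_0 [simp]: "eis_norm 0 = 0"
  by (simp add: eis_norm_def)

lemma eis_norm_eq_0_iff [simp]: "eis_norm x = 0 \<longleftrightarrow> x = 0"
proof
  assume "eis_norm x = 0"
  then have *: "(2 * rat_part x - om_part x)\<^sup>2 + 3 * (om_part x)\<^sup>2 = 0"
    using four_eis_norm[of x] by simp
  have "(2 * rat_part x - om_part x)\<^sup>2 \<ge> 0" "(om_part x)\<^sup>2 \<ge> 0"
    by simp_all
  with * have "(om_part x)\<^sup>2 = 0" "(2 * rat_part x - om_part x)\<^sup>2 = 0"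
    by linarith+
  then show "x = 0"
    by (simp add: eis_eq_iff)
qed simp

lemma eis_norm_pos: "x \<noteq> 0 \<Longrightarrow> eis_norm x > 0"
  using eis_norm_nonneg[of x] eis_norm_eq_0_iff[of x] by linarith

definition eis_cnj :: "eisenstein \<Rightarrow> eisenstein" where
  "eis_cnj x = Eis (rat_part x - om_part x) (- om_part x)"

lemma eis_cnj_parts [simp]:
  "rat_part (eis_cnj x) = rat_part x - om_part x" "om_part (eis_cnj x) = - om_part x"
  by (simp_all add: eis_cnj_def)

lemma eis_norm_cnj [simp]: "eis_norm (eis_cnj x) = eis_norm x"
  by (simp add: eis_norm_def power2_eq_square algebra_simps)

text \<open>Division rounds both coordinates of the exact quotient \<open>x * eis_cnj y / eis_norm y\<close> down;
  in particular it is the exact quotient whenever \<open>y\<close> divides \<open>x\<close>.\<close>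

instantiation eisenstein :: idom_modulo
begin

definition "x div y =
  Eis (rat_part (x * eis_cnj y) div eis_norm y) (om_part (x * eis_cnj y) div eis_norm y)"
definition "x mod y = x - x div y * (y :: eisenstein)"

instance
proof
  fix x y :: eisenstein
  show "x div 0 = 0"
    by (simp add: divide_eisenstein_def eis_eq_iff)
  show "x div y * y + x mod y = x"
    by (simp add: modulo_eisenstein_def)
  show "x * y \<noteq> 0" if "x \<noteq> 0" "y \<noteq> 0"
    using that by (metis eis_norm_eq_0_iff eis_norm_mult mult_eq_0_iff)
  show "x * y div y = x" if "y \<noteq> 0"
  proof -
    have "rat_part (x * y * eis_cnj y) = rat_part x * eis_norm y"
         "om_part (x * y * eis_cnj y) = om_part x * eis_norm y"
      by (simp_all add: eis_norm_def power2_eq_square algebra_simps)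
    with that show ?thesis
      by (simp only: divide_eisenstein_def) (simp add: eis_eq_iff)
  qed
qed

end

lemma eis_form_less_square:
  fixes s t m :: int
  assumes "0 \<le> s" "s < m" "0 \<le> t" "t < m"
  shows "s\<^sup>2 - s * t + t\<^sup>2 < m\<^sup>2"
proof (cases "s \<le> t")
  case True
  then have "s * s \<le> s * t" using assms by (simp add: mult_left_mono)
  moreover have "t * t < m * m" using assms by (intro mult_strict_mono) auto
  ultimately show ?thesis by (simp add: power2_eq_square)
next
  case False
  then have "t * t \<le> s * t" using assms by (simp add: mult_right_mono)
  moreover have "s * s < m * m" using assms by (intro mult_strict_mono) auto
  ultimately show ?thesis by (simp add: power2_eq_square)
qed

instantiation eisenstein :: euclidean_ring
begin

definition "euclidean_size x = nat (eis_norm x)"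

instance
proof
  show "euclidean_size (0 :: eisenstein) = 0"
    by (simp add: euclidean_size_eisenstein_def)
  fix x y :: eisenstein
  assume y: "y \<noteq> 0"
  define m where "m = eis_norm y"
  have m: "m > 0" using y by (simp add: m_def eis_norm_pos)
  define z where "z = x * eis_cnj y"
  have yy: "y * eis_cnj y = Eis m 0"
    by (simp add: eis_eq_iff m_def eis_norm_def power2_eq_square algebra_simps)
  have "(x mod y) * eis_cnj y = z - (x div y) * Eis m 0"
    by (simp add: modulo_eisenstein_def z_def left_diff_distrib mult.assoc yy)
  also have "\<dots> = Eis (rat_part z mod m) (om_part z mod m)"
    by (simp add: eis_eq_iff divide_eisenstein_def minus_mult_div_eq_mod
          minus_div_mult_eq_mod flip: z_def m_def)
  finally have "eis_norm (x mod y) * m = eis_norm (Eis (rat_part z mod m) (om_part z mod m))"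
    by (metis eis_norm_mult eis_norm_cnj m_def)
  also have "\<dots> < m * m"
    unfolding eis_norm_def using m
    by (simp add: eis_form_less_square flip: power2_eq_square)
  finally have "eis_norm (x mod y) < m" using m by simp
  then show "euclidean_size (x mod y) < euclidean_size y"
    using m by (simp add: euclidean_size_eisenstein_def m_def)
  have "eis_norm x * 1 \<le> eis_norm x * eis_norm y"
    using m eis_norm_nonneg[of x] unfolding m_def by (intro mult_left_mono) auto
  then show "euclidean_size x \<le> euclidean_size (x * y)"
    by (simp add: euclidean_size_eisenstein_def eis_norm_mult)
qed

end

subsection \<open>Units and the normal form\<close>

lemma eis_norm_unit:
  assumes "is_unit (u :: eisenstein)"
  shows "eis_norm u = 1"
proof -
  from assms obtain v where "1 = u * v" by (auto simp: dvd_def)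
  then have "eis_norm u * eis_norm v = 1"
    by (simp flip: eis_norm_mult add: eis_norm_def[of 1])
  then show ?thesis
    using eis_norm_nonneg[of u] by (auto simp: zmult_eq_1_iff)
qed

lemma is_unit_eis_iff:
  "is_unit (u :: eisenstein) \<longleftrightarrow>
     u \<in> {Eis 1 0, Eis 1 1, Eis 0 1, Eis (- 1) 0, Eis (- 1) (- 1), Eis 0 (- 1)}"
proof
  assume "is_unit u"
  then have n: "4 = (2 * rat_part u - om_part u)\<^sup>2 + 3 * (om_part u)\<^sup>2"
    using four_eis_norm[of u] eis_norm_unit[of u] by simp
  have "(2 * rat_part u - om_part u)\<^sup>2 \<ge> 0" "(om_part u)\<^sup>2 \<ge> 0" by simp_all
  then have "(om_part u)\<^sup>2 < 2\<^sup>2" "(2 * rat_part u - om_part u)\<^sup>2 < 3\<^sup>2"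
    unfolding power2_eq_square[of 2] power2_eq_square[of 3] using n by linarith+
  then have "\<bar>om_part u\<bar> < 2" "\<bar>2 * rat_part u - om_part u\<bar> < 3"
    using power2_less_imp_less[of "\<bar>om_part u\<bar>" 2] power2_less_imp_less[of "\<bar>2 * rat_part u - om_part u\<bar>" 3]
    by simp_all
  then have "om_part u = -1 \<or> om_part u = 0 \<or> om_part u = 1"
      "rat_part u = -1 \<or> rat_part u = 0 \<or> rat_part u = 1" by linarith+
  with n show "u \<in> {Eis 1 0, Eis 1 1, Eis 0 1, Eis (- 1) 0, Eis (- 1) (- 1), Eis 0 (- 1)}"
    by (auto simp: eis_eq_iff)
next
  have w: "1 = Eis 1 0 * Eis 1 0" "1 = Eis 1 1 * Eis 0 (- 1)" "1 = Eis 0 1 * Eis (- 1) (- 1)"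
     "1 = Eis (- 1) 0 * Eis (- 1) 0" "1 = Eis (- 1) (- 1) * Eis 0 1" "1 = Eis 0 (- 1) * Eis 1 1"
    by (simp_all add: eis_eq_iff)
  assume "u \<in> {Eis 1 0, Eis 1 1, Eis 0 1, Eis (- 1) 0, Eis (- 1) (- 1), Eis 0 (- 1)}"
  then show "is_unit u" using w[THEN dvdI] by auto
qed

text \<open>The normal form is the associate \<open>a + b\<omega>\<close> with \<open>a > b \<ge> 0\<close>.\<close>

instantiation eisenstein :: normalization_euclidean_semiring
begin

definition "unit_factor x = (let a = rat_part x; b = om_part x in
  if x = 0 then 0
  else if 0 \<le> b \<and> b < a then Eis 1 0
  else if 0 < a \<and> a \<le> b then Eis 1 1
  else if a \<le> 0 \<and> 0 < b then Eis 0 1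
  else if b \<le> 0 \<and> a < b then Eis (- 1) 0
  else if a < 0 \<and> b \<le> a then Eis (- 1) (- 1)
  else Eis 0 (- 1))"

definition "normalize x = x * eis_cnj (unit_factor x)"

lemma unit_factor_eis_mult:
  assumes "is_unit v" "0 \<le> om_part w" "om_part w < rat_part w"
  shows "unit_factor (v * w) = (v :: eisenstein)"
  using assms(1)[unfolded is_unit_eis_iff] assms(2,3)
  by (elim insertE emptyE) (simp_all add: unit_factor_eisenstein_def Let_def eis_eq_iff)

lemma unit_factor_mult_normalize_eis: "unit_factor x * normalize x = (x :: eisenstein)"
  by (simp add: normalize_eisenstein_def unit_factor_eisenstein_def Let_def eis_eq_iff)

lemma is_unit_unit_factor_eis: "x \<noteq> 0 \<Longrightarrow> is_unit (unit_factor (x :: eisenstein))"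
  by (simp add: is_unit_eis_iff unit_factor_eisenstein_def Let_def)

lemma normalize_eis_sector:
  "x \<noteq> 0 \<Longrightarrow> 0 \<le> om_part (normalize x) \<and> om_part (normalize x) < rat_part (normalize x)"
  by (simp add: normalize_eisenstein_def unit_factor_eisenstein_def Let_def eis_eq_iff) linarith

instance
proof
  show "unit_factor (0 :: eisenstein) = 0"
    by (simp add: unit_factor_eisenstein_def)
  show "normalize (0 :: eisenstein) = 0"
    by (simp add: normalize_eisenstein_def)
  fix x y :: eisenstein
  show "unit_factor x = x" if "is_unit x"
    using unit_factor_eis_mult[OF that, of 1] by simp
  show "is_unit (unit_factor x)" if "x \<noteq> 0"
    using that by (rule is_unit_unit_factor_eis)
  show "unit_factor x * normalize x = x"
    by (rule unit_factor_mult_normalize_eis)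
  show "unit_factor (x * y) = x * unit_factor y" if x: "is_unit x"
  proof (cases "y = 0")
    case True
    then show ?thesis by (simp add: unit_factor_eisenstein_def)
  next
    case False
    have "is_unit (x * unit_factor y)"
      using mult_dvd_mono[OF x is_unit_unit_factor_eis[OF False]] by simp
    then have "unit_factor (x * unit_factor y * normalize y) = x * unit_factor y"
      using normalize_eis_sector[OF False] by (intro unit_factor_eis_mult) auto
    then show ?thesis
      by (simp only: mult.assoc unit_factor_mult_normalize_eis)
  qed
qed

end

section \<open>Positive primes and the divisor sum\<close>

definition positive_prime :: "eisenstein \<Rightarrow> bool" where
  "positive_prime p \<longleftrightarrow> prime_elem p \<and> rat_part p > om_part p \<and> om_part p \<ge> 0"

text \<open>Since \<open>\<int>[\<omega>]\<close> is factorial, the exponent of \<open>\<pi>\<close> in \<open>\<alpha>\<close> is its multiplicity.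
  The quotient is exact (\<open>positive_prime_quotient_exact\<close>); \<open>eis_sigma_factorization\<close> recovers the formula
  in terms of a given factorization. Only nonzero arguments are meaningful.\<close>

definition eis_sigma :: "eisenstein \<Rightarrow> eisenstein" where
  "eis_sigma x = (\<Prod>p \<in> {p. positive_prime p \<and> p dvd x}.
     (p ^ (multiplicity p x + 1) - 1) div (p - 1))"

lemma positive_prime_iff_prime: "positive_prime p \<longleftrightarrow> prime p"
proof (cases "p = 0")
  case False
  have "normalize p = p \<longleftrightarrow> rat_part p > om_part p \<and> om_part p \<ge> 0"
    using False
    by (auto simp: normalize_eisenstein_def unit_factor_eisenstein_def Let_def eis_eq_iff)
  then show ?thesis
    by (auto simp: positive_prime_def prime_def)
qed (auto simp: positive_prime_def)

lemma ex1_positive_associate: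
  assumes "prime_elem (x :: eisenstein)"
  shows "\<exists>!p. positive_prime p \<and> (\<exists>u. is_unit u \<and> x = u * p)"
proof (rule ex1I[of _ "normalize x"])
  have "x \<noteq> 0" using assms by auto
  then show "positive_prime (normalize x) \<and> (\<exists>u. is_unit u \<and> x = u * normalize x)"
    using assms by (auto simp: positive_prime_iff_prime intro!: exI[of _ "unit_factor x"])
next
  fix p
  assume "positive_prime p \<and> (\<exists>u. is_unit u \<and> x = u * p)"
  then show "p = normalize x"
    by (auto simp: positive_prime_iff_prime normalize_mult_unit_left)
qed

lemma positive_prime_divisors:
  "x \<noteq> 0 \<Longrightarrow> {p. positive_prime p \<and> p dvd x} = prime_factors x"
  by (auto simp: positive_prime_iff_prime prime_factors_dvd)

lemma positive_prime_quotient_exact: "p - 1 dvd p ^ n - (1 :: eisenstein)"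
  by (cases n) (simp_all add: power_diff_1_eq del: power_Suc)

lemma eis_sigma_factorization:
  assumes "finite S" "\<And>p. p \<in> S \<Longrightarrow> positive_prime p" "\<And>p. p \<in> S \<Longrightarrow> e p > 0" "is_unit u"
  shows "eis_sigma (u * (\<Prod>p\<in>S. p ^ e p)) = (\<Prod>p\<in>S. (p ^ (e p + 1) - 1) div (p - 1))"
proof -
  define x where "x = u * (\<Prod>p\<in>S. p ^ e p)"
  have pr: "prime p" if "p \<in> S" for p
    using assms(2)[OF that] by (simp add: positive_prime_iff_prime)
  have nz: "0 \<notin> S" using pr[of 0] by auto
  have "u \<noteq> 0" using assms(4) by auto
  then have "x \<noteq> 0"
    using assms(1) nz unfolding x_def by auto
  have mult: "multiplicity p x = (if p \<in> S then e p else 0)" if p: "prime p" for p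
  proof -
    have "multiplicity p x = multiplicity p (\<Prod>q\<in>S. q ^ e q)"
      unfolding x_def using assms(4) by (rule multiplicity_times_unit_right)
    also have "\<dots> = (\<Sum>q\<in>S. multiplicity p (q ^ e q))"
      using assms(1) nz p by (intro prime_elem_multiplicity_prod_distrib) auto
    also have "\<dots> = (\<Sum>q\<in>S. if q = p then e p else 0)"
      using p pr by (intro sum.cong) (auto simp: multiplicity_same_power multiplicity_distinct_prime_power)
    finally show ?thesis using assms(1) by simp
  qed
  have "{p. positive_prime p \<and> p dvd x} = S"
  proof (intro equalityI subsetI)
    fix p assume "p \<in> {p. positive_prime p \<and> p dvd x}"
    then show "p \<in> S"
      using mult[of p] \<open>x \<noteq> 0\<close>
      by (auto simp: positive_prime_iff_prime prime_elem_multiplicity_eq_zero_iff split: if_splits)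
  next
    fix p assume "p \<in> S"
    then show "p \<in> {p. positive_prime p \<and> p dvd x}"
      using mult[of p] assms(3)[of p] pr[of p] \<open>x \<noteq> 0\<close> 
      by (auto simp: positive_prime_iff_prime prime_multiplicity_gt_zero_iff[symmetric])
  qed
  then show ?thesis
    unfolding eis_sigma_def x_def[symmetric]
    by (auto intro!: prod.cong simp: mult pr)
qed

end

theory Submission
  imports Defs
begin

text \<open>The factor \<open>u\<close> makes this apply to every prime, since each is a unit times
  its positive associate.\<close>

lemma eis_sigma_prime:
  assumes "positive_prime p" "is_unit u"
  shows "eis_sigma (u * p) = p + 1"
proof -
  have "p \<noteq> 1"
    using assms(1) by (auto simp: positive_prime_def)
  have "eis_sigma (u * p) = (p ^ 2 - 1) div (p - 1)"
    using eis_sigma_factorization[of "{p}" "\<lambda>_. 1" u] assms by (simp add: power2_eq_square)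
  also have "p ^ 2 - 1 = (p + 1) * (p - 1)"
    by (simp add: power2_eq_square algebra_simps)
  also have "\<dots> div (p - 1) = p + 1"
    using \<open>p \<noteq> 1\<close> by (intro nonzero_mult_div_cancel_right) simp
  finally show ?thesis .
qed

text \<open>Expanding \<open>N(x + 1) = 3 N(x)\<close> for \<open>x = a + b\<omega>\<close> gives \<open>2 N(x) = 2a + 1 - b\<close>. Since
  \<open>N(x) = a(a - b) + b\<^sup>2 \<ge> a + b\<^sup>2\<close> in the sector, this forces \<open>b = 0\<close>, and parity excludes
  \<open>2a\<^sup>2 = 2a + 1\<close>.\<close>

lemma eis_norm_plus_1_neq:
  assumes "0 \<le> om_part x" "om_part x < rat_part x"
  shows "eis_norm (x + 1) \<noteq> 3 * eis_norm x"
proof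
  define a b where "a = rat_part x" and "b = om_part x"
  assume "eis_norm (x + 1) = 3 * eis_norm x"
  then have eq: "2 * (a * (a - b) + b * b) = 2 * a + 1 - b"
    by (simp add: eis_norm_def power2_eq_square algebra_simps a_def b_def)
  \<comment> \<open>Over the integers, b < a means a - b \<ge> 1.\<close>
  have "a * 1 \<le> a * (a - b)"
    using assms by (intro mult_left_mono) (auto simp: a_def b_def)
  with eq have "2 * (b * b) + b \<le> 1"
    by (simp add: algebra_simps)
  \<comment> \<open>So b \<ge> 1 would give 2b^2 + b \<ge> 3, against the bound 1.\<close>
  moreover have "b * 1 \<le> b * b" if "b \<ge> 1"
    using that by (intro mult_left_mono) auto
  ultimately have "b = 0"
    using assms by (fastforce simp: b_def)
  with eq have "2 * (a * a) = 2 * a + 1"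
    by simp
  then show False
    by presburger
qed

theorem mainTheorem13:
  shows "\<not> (\<exists>\<psi> :: eisenstein. prime_elem \<psi> \<and> eis_norm (eis_sigma \<psi>) = 3 * eis_norm \<psi>)"
proof
  assume "\<exists>\<psi>. prime_elem \<psi> \<and> eis_norm (eis_sigma \<psi>) = 3 * eis_norm \<psi>"
  then obtain \<psi> where \<psi>: "prime_elem \<psi>" "eis_norm (eis_sigma \<psi>) = 3 * eis_norm \<psi>"
    by blast
  then obtain p u where p: "positive_prime p" "is_unit u" "\<psi> = u * p"
    using ex1_positive_associate by blast
  \<comment> \<open>The unit drops out on both sides: \<open>eis_sigma\<close> ignores it, and its
    norm is 1.\<close>
  then have "eis_norm (p + 1) = 3 * eis_norm p"
    using \<psi>(2) by (simp add: eis_sigma_prime eis_norm_mult eis_norm_unit)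
  then show False
    using p(1) eis_norm_plus_1_neq[of p] by (simp add: positive_prime_def)
qed

end
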